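(* Let $A>0$, $B>0$, $c>0$, and put $M=A/B$, $\delta=c/B$. With inverse demand $P(Q)=A-BQ$ and quadratic costs $C_i(x_i)=cx_i^2$ for every firm, let $Q_n^{S,Q}$ denote the aggregate output in the subgame-perfect equilibrium of the $n$-firm canonical hierarchical Stackelberg model, let $P_n^{S,Q}=A-BQ_n^{S,Q}$ be the equilibrium price, and let $q_n=Q_n^{S,Q}/M$ for $n\ge0$. Then $0\le q_n<1$ for all $n\ge0$, and the sequence is strictly increasing: $q_n>q_{n-1}$ for all $n\ge1$. Consequently, $\lim_{n\to\infty}q_n=1$, hence $$\lim_{n\to\infty}Q_n^{S,Q}=M=\frac{A}{B},$$ and the equilibrium price satisfies $\lim_{n\to\infty}P_n^{S,Q}=0$.
   Context: Canonical hierarchical Stackelberg model. Firms $1,\dots,n$ produce a homogeneous good and choose outputs $x_i\ge0$ sequentially in the order $1,2,\dots,n$; each firm observes the outputs of all its predecessors. With $Q=\sum_{j=1}^n x_j$, firm $i$'s payoff is $\Pi_i(x_1,\dots,x_n)=x_i(A-BQ)-C_i(x_i)$. A strategy of firm $k$ is a function $\sigma_k:[0,\infty)^{k-1}\to[0,\infty)$ of the history $(x_1,\dots,x_{k-1})$. The profile $(\sigma_1,\dots,\sigma_n)$ is a subgame-perfect equilibrium if for every $k$ and every history, $\sigma_k(x_1,\dots,x_{k-1})$ maximizes firm $k$'s payoff over $x_k\ge0$ when all later firms follow $\sigma_{k+1},\dots,\sigma_n$. The equilibrium outputs are those generated along the path, $x_k=\sigma_k(x_1,\dots,x_{k-1})$,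 and the aggregate equilibrium output is their sum. For $n=0$ the aggregate output is $0$. The normalized outputs satisfy $q_0=0$ and $q_n=q_{n-1}+\frac{(1-q_{n-1})^2}{2(1-q_{n-1}+\delta)}$ for $n\ge1$. *)

theory Defs
  imports Complex_Main "HOL-Library.FuncSet"
begin

text \<open>
  Firms are numbered from 1. A history or an output profile is the list of the
  outputs chosen so far, in the order of play, so firm \<open>k\<close> moves after a history of
  length \<open>k - 1\<close> and its output is the list entry with index \<open>k - 1\<close>.
\<close>

type_synonym profile = "nat \<Rightarrow> real list \<Rightarrow> real"

definition histories :: "nat \<Rightarrow> real list set" where
  "histories k = {h. length h = k - 1 \<and> set h \<subseteq> {0..}}"

text \<open>
  Strategies are extensional functions on the histories of their firm. Two profiles
  that prescribe the same outputs at all histories are therefore equal.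
\<close>

definition profiles :: "nat \<Rightarrow> profile set" where
  "profiles n = (\<Pi>\<^sub>E k\<in>{1..n}. histories k \<rightarrow>\<^sub>E {0..})"

primrec continue :: "profile \<Rightarrow> nat \<Rightarrow> real list \<Rightarrow> real list" where
  "continue \<sigma> 0 h = h"
| "continue \<sigma> (Suc m) h = continue \<sigma> m (h @ [\<sigma> (Suc (length h)) h])"

definition outcome :: "nat \<Rightarrow> profile \<Rightarrow> real list \<Rightarrow> real list" where
  "outcome n \<sigma> h = continue \<sigma> (n - length h) h"

definition payoff :: "real \<Rightarrow> real \<Rightarrow> (nat \<Rightarrow> real \<Rightarrow> real) \<Rightarrow> nat \<Rightarrow> real list \<Rightarrow> real" where
  "payoff A B C i xs = xs ! (i - 1) * (A - B * sum_list xs) - C i (xs ! (i - 1))"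

definition subgame_perfect ::
  "real \<Rightarrow> real \<Rightarrow> (nat \<Rightarrow> real \<Rightarrow> real) \<Rightarrow> nat \<Rightarrow> profile \<Rightarrow> bool" where
  "subgame_perfect A B C n \<sigma> \<longleftrightarrow>
     \<sigma> \<in> profiles n \<and>
     (\<forall>k\<in>{1..n}. \<forall>h\<in>histories k. \<forall>y\<ge>0.
        payoff A B C k (outcome n \<sigma> (h @ [y])) \<le>
        payoff A B C k (outcome n \<sigma> (h @ [\<sigma> k h])))"

definition stackelberg_output :: "real \<Rightarrow> real \<Rightarrow> (nat \<Rightarrow> real \<Rightarrow> real) \<Rightarrow> nat \<Rightarrow> real" where
  "stackelberg_output A B C n =
     sum_list (outcome n (THE \<sigma>. subgame_perfect A B C n \<sigma>) [])"

end

theory Submission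
  imports Defs
begin

text \<open>
  Put \<open>M = A / B\<close> and \<open>\<delta> = c / B\<close>, and measure everything in terms of the gap
  \<open>M - Q\<close> between the competitive quantity and aggregate output; the price is \<open>B\<close> times this gap, and negative if the market is
  oversupplied. The reason for the result is that the gap scales: if the firms still to move
  turn a positive gap \<open>r\<close> into \<open>a r\<close>, then a firm that faces the gap \<open>R\<close> and produces \<open>x < R\<close>
  earns \<open>B (a x (R - x) - \<delta> x\<^sup>2)\<close>. This parabola has its peak at a fixed fraction of \<open>R\<close>, the
  fraction \<open>lead_share \<delta> a = a / (2 (a + \<delta>))\<close>, so this firm and its followers together again
  multiply the gap by a constant. If the gap is not positive, all firms produce nothing.

  Completing the square shows that the peak is the only best choice, also against outputs that
  flood the market (\<open>leader_optimum\<close>). Backward induction therefore determines every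
  subgame-perfect strategy at every history, on and off the path, and gives existence and
  uniqueness at once (\<open>subgame_perfect_iff_reply\<close>, \<open>subgame_perfect_iff_eq\<close>).

  Along the path the gap ends at \<open>M\<close> times \<open>a\<^sub>n = unserved \<delta> n\<close>, so \<open>q\<^sub>n = 1 - a\<^sub>n\<close>, where \<open>a\<^sub>0 = 1\<close>
  and \<open>a\<^sub>n\<^sub>+\<^sub>1 = a\<^sub>n - a\<^sub>n\<^sup>2 / (2 (a\<^sub>n + \<delta>))\<close>. This sequence is positive and strictly decreasing.
  It converges, and by continuity its limit is a fixed point of the recursion; the only
  nonnegative one is \<open>0\<close>.
\<close>

section \<open>The decision of a single firm\<close>

definition lead_share :: "real \<Rightarrow> real \<Rightarrow> real" where
  "lead_share d a = a / (2 * (a + d))"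

text \<open>
  The gap that the followers leave when they find the gap \<open>r\<close>: they serve part of an open market
  but cannot undo an oversupply.
\<close>

definition remaining_gap :: "real \<Rightarrow> real \<Rightarrow> real" where
  "remaining_gap a r = (if r > 0 then a * r else r)"

lemma lead_share_bounds:
  assumes "a > 0" "d > 0"
  shows "0 < lead_share d a" "lead_share d a < 1"
  using assms by (auto simp: lead_share_def field_simps)

text \<open>
  For \<open>y < R\<close> the profit is a parabola with peak \<open>t\<close>, and the loss against the peak is
  \<open>(a + d) (y - t)\<^sup>2\<close>. For positive \<open>y \<ge> R\<close> revenue is not positive, so the firm makes a loss,
  while \<open>t\<close> yields at least \<open>0\<close>.
\<close>

lemma leader_optimum:
  fixes a d R y :: real
  assumes "a > 0" "d > 0" "y \<ge> 0"
  defines "t \<equiv> lead_share d a * max 0 R"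
  assumes "y \<noteq> t"
  shows "y * remaining_gap a (R - y) - d * y\<^sup>2 < t * remaining_gap a (R - t) - d * t\<^sup>2"
proof (cases "R > 0")
  case True
  then have t: "t = lead_share d a * R" by (simp add: t_def)
  have "t < R" using True lead_share_bounds(2)[OF assms(1,2)] by (simp add: t)
  have peak: "2 * (a + d) * t = a * R"
    using assms(1,2) by (simp add: t lead_share_def)
  have peak_value: "t * remaining_gap a (R - t) - d * t\<^sup>2 = (a + d) * t\<^sup>2"
  proof -
    have "t * (a * (R - t)) - d * t\<^sup>2 = t * (a * R) - (a + d) * t\<^sup>2"
      by (simp add: algebra_simps power2_eq_square)
    also have "\<dots> = (a + d) * t\<^sup>2"
      unfolding peak[symmetric] by (simp add: algebra_simps power2_eq_square)
    finally show ?thesis using \<open>t < R\<close> by (simp add: remaining_gap_def)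
  qed
  show ?thesis
  proof (cases "y < R")
    case True
    have "y * (a * (R - y)) - d * y\<^sup>2 = y * (a * R) - (a + d) * y\<^sup>2"
      by (simp add: algebra_simps power2_eq_square)
    also have "\<dots> = (a + d) * t\<^sup>2 - (a + d) * (y - t)\<^sup>2"
      unfolding peak[symmetric] by (simp add: algebra_simps power2_eq_square)
    also have "\<dots> < (a + d) * t\<^sup>2"
      using assms(1,2) \<open>y \<noteq> t\<close> by simp
    finally show ?thesis using True peak_value by (simp add: remaining_gap_def)
  next
    case False
    then have "y * (R - y) \<le> 0" using assms(3) by (simp add: mult_nonneg_nonpos)
    moreover have "0 < d * y\<^sup>2" using False \<open>R > 0\<close> assms(2) by simp
    moreover have "0 \<le> (a + d) * t\<^sup>2" using assms(1,2) by simp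
    ultimately show ?thesis using False peak_value by (simp add: remaining_gap_def)
  qed
next
  case False
  then have "t = 0" by (simp add: t_def)
  then have "y > 0" using \<open>y \<noteq> t\<close> assms(3) by simp
  then have "y * (R - y) < 0" "0 < d * y\<^sup>2"
    using False assms(2) by (auto intro: mult_pos_neg)
  then show ?thesis using False \<open>t = 0\<close> \<open>y > 0\<close> by (simp add: remaining_gap_def)
qed

section \<open>The unserved share of the market\<close>

primrec unserved :: "real \<Rightarrow> nat \<Rightarrow> real" where
  "unserved d 0 = 1"
| "unserved d (Suc m) = unserved d m * (1 - lead_share d (unserved d m))"

lemma unserved_pos: "d > 0 \<Longrightarrow> unserved d m > 0"
  by (induction m) (simp_all add: lead_share_bounds)

lemma unserved_decreasing: "d > 0 \<Longrightarrow> unserved d (Suc m) < unserved d m"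
  using unserved_pos[of d m] by (simp add: lead_share_bounds)

lemma unserved_le_1: "d > 0 \<Longrightarrow> unserved d m \<le> 1"
  by (induction m) (auto dest: order_trans[OF less_imp_le[OF unserved_decreasing]])

text \<open>
  A limit \<open>L\<close> of the recursion satisfies \<open>L = L (1 - lead_share d L)\<close>, and \<open>lead_share d L\<close> vanishes
  only if \<open>L\<close> does.
\<close>

lemma unserved_tendsto_0:
  assumes "d > 0"
  shows "unserved d \<longlonglongrightarrow> 0"
proof -
  have "decseq (unserved d)"
    using unserved_decreasing[OF assms] by (auto intro!: decseq_SucI less_imp_le)
  moreover have "\<And>m. 0 \<le> unserved d m" using unserved_pos[OF assms] less_imp_le by blast
  ultimately obtain L where L: "unserved d \<longlonglongrightarrow> L" and "\<forall>m. L \<le> unserved d m"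
    using decseq_convergent by metis
  have "L \<ge> 0"
    using L by (rule LIMSEQ_le_const) (use unserved_pos[OF assms] less_imp_le in blast)
  have "(\<lambda>m. unserved d (Suc m)) \<longlonglongrightarrow> L * (1 - lead_share d L)"
    unfolding unserved.simps lead_share_def
    using L assms \<open>L \<ge> 0\<close> by (intro tendsto_intros) auto
  moreover have "(\<lambda>m. unserved d (Suc m)) \<longlonglongrightarrow> L" using L by (rule LIMSEQ_Suc)
  ultimately have "L = L * (1 - lead_share d L)" using LIMSEQ_unique by blast
  then have "L = 0 \<or> lead_share d L = 0" by (simp add: algebra_simps)
  then have "L = 0" using assms \<open>L \<ge> 0\<close> by (auto simp: lead_share_def)
  then show ?thesis using L by simp
qed

section \<open>Backward induction\<close>

text \<open>
  The output of firm \<open>k\<close> that backward induction selects: \<open>n - k\<close> firms are still to move after it,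
  and an oversupplied market induces it to produce nothing.
\<close>

definition stackelberg_reply :: "real \<Rightarrow> real \<Rightarrow> nat \<Rightarrow> profile" where
  "stackelberg_reply M d n k h =
     lead_share d (unserved d (n - k)) * max 0 (M - sum_list h)"

definition stackelberg_profile :: "real \<Rightarrow> real \<Rightarrow> nat \<Rightarrow> profile" where
  "stackelberg_profile M d n =
     (\<lambda>k\<in>{1..n}. \<lambda>h\<in>histories k. stackelberg_reply M d n k h)"

lemma stackelberg_reply_nonneg: "d > 0 \<Longrightarrow> stackelberg_reply M d n k h \<ge> 0"
  unfolding stackelberg_reply_def
  by (intro mult_nonneg_nonneg less_imp_le[OF lead_share_bounds(1)] unserved_pos) auto

lemma nth_continue: "i < length h \<Longrightarrow> continue \<sigma> m h ! i = h ! i"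
  by (induction m arbitrary: h) (simp_all add: nth_append)

text \<open>
  The replies scale with the gap, hence so does the gap that remains after them. The premise
  speaks only of the firms that move after \<open>h\<close>, because in the middle of a backward induction
  only their strategies are known.
\<close>

lemma gap_continue:
  assumes d: "d > 0"
  shows "length h + m = n \<Longrightarrow> set h \<subseteq> {0..} \<Longrightarrow>
    (\<And>k g. length h < k \<Longrightarrow> k \<le> n \<Longrightarrow> g \<in> histories k \<Longrightarrow>
      \<sigma> k g = stackelberg_reply M d n k g) \<Longrightarrow>
    M - sum_list (continue \<sigma> m h) = remaining_gap (unserved d m) (M - sum_list h)"
proof (induction m arbitrary: h)
  case 0
  then show ?case by (simp add: remaining_gap_def)
next
  case (Suc m)
  let ?s = "lead_share d (unserved d m)"
  let ?x = "\<sigma> (Suc (length h)) h"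
  have s: "?s < 1" using d unserved_pos lead_share_bounds(2) by blast
  have "n - Suc (length h) = m" using Suc.prems(1) by simp
  then have x: "?x = ?s * max 0 (M - sum_list h)"
    using Suc.prems by (auto simp: histories_def stackelberg_reply_def)
  have "?x \<ge> 0"
    unfolding x using d
    by (intro mult_nonneg_nonneg less_imp_le[OF lead_share_bounds(1)] unserved_pos) auto
  then have "M - sum_list (continue \<sigma> m (h @ [?x]))
      = remaining_gap (unserved d m) (M - sum_list (h @ [?x]))"
    using Suc.prems by (intro Suc.IH) auto
  also have "\<dots> = remaining_gap (unserved d (Suc m)) (M - sum_list h)"
  proof (cases "M - sum_list h > 0")
    case True
    have "M - sum_list (h @ [?x]) = (1 - ?s) * (M - sum_list h)"
      using True by (simp add: x algebra_simps)
    moreover have "(1 - ?s) * (M - sum_list h) > 0" using True s by simp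
    ultimately show ?thesis using True by (simp add: remaining_gap_def)
  next
    case False
    then show ?thesis by (simp add: x remaining_gap_def)
  qed
  finally show ?case by simp
qed

lemma payoff_continuation:
  assumes "B > 0" "c > 0" "k \<in> {1..n}" "h \<in> histories k" "y \<ge> 0"
    and follow: "\<And>j g. k < j \<Longrightarrow> j \<le> n \<Longrightarrow> g \<in> histories j \<Longrightarrow>
      \<sigma> j g = stackelberg_reply (A / B) (c / B) n j g"
  shows "payoff A B (\<lambda>i x. c * x\<^sup>2) k (outcome n \<sigma> (h @ [y])) =
    B * (y * remaining_gap (unserved (c / B) (n - k)) (A / B - sum_list h - y) - c / B * y\<^sup>2)"
proof -
  have h: "length h = k - 1" "set h \<subseteq> {0..}" using assms(4) by (auto simp: histories_def)
  have len: "length (h @ [y]) = k" using h(1) assms(3) by simp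
  have own: "outcome n \<sigma> (h @ [y]) ! (k - 1) = y"
    using nth_continue[of "k - 1" "h @ [y]" \<sigma>] h(1) len
    by (simp add: outcome_def nth_append)
  have "A / B - sum_list (continue \<sigma> (n - k) (h @ [y])) =
      remaining_gap (unserved (c / B) (n - k)) (A / B - sum_list (h @ [y]))"
    using assms h(2) len by (intro gap_continue) auto
  then have gap: "A / B - sum_list (outcome n \<sigma> (h @ [y])) =
      remaining_gap (unserved (c / B) (n - k)) (A / B - sum_list h - y)"
    using len by (simp add: outcome_def algebra_simps)
  have "payoff A B (\<lambda>i x. c * x\<^sup>2) k (outcome n \<sigma> (h @ [y])) =
      B * (y * (A / B - sum_list (outcome n \<sigma> (h @ [y]))) - c / B * y\<^sup>2)"
    unfolding payoff_def own using assms(1) by (simp add: field_simps)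
  then show ?thesis by (simp only: gap)
qed

text \<open>
  One step of backward induction: once the later firms follow their replies, the payoff of firm
  \<open>k\<close> is \<open>B\<close> times the profit in \<open>leader_optimum\<close> at the gap \<open>A / B - sum_list h\<close>.
\<close>

lemma optimal_iff_reply:
  assumes "B > 0" "c > 0" "k \<in> {1..n}" "h \<in> histories k" "x \<ge> 0"
    and follow: "\<And>j g. k < j \<Longrightarrow> j \<le> n \<Longrightarrow> g \<in> histories j \<Longrightarrow>
      \<sigma> j g = stackelberg_reply (A / B) (c / B) n j g"
  shows "(\<forall>y\<ge>0. payoff A B (\<lambda>i x. c * x\<^sup>2) k (outcome n \<sigma> (h @ [y])) \<le>
        payoff A B (\<lambda>i x. c * x\<^sup>2) k (outcome n \<sigma> (h @ [x])))
    \<longleftrightarrow> x = stackelberg_reply (A / B) (c / B) n k h" (is "?optimal \<longleftrightarrow> x = ?t")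
proof -
  let ?\<pi> = "\<lambda>y. payoff A B (\<lambda>i x. c * x\<^sup>2) k (outcome n \<sigma> (h @ [y]))"
  have t: "?t \<ge> 0" using assms(1,2) by (simp add: stackelberg_reply_nonneg)
  have better: "?\<pi> y < ?\<pi> ?t" if y: "y \<ge> 0" "y \<noteq> ?t" for y
  proof -
    have "?\<pi> z = B * (z * remaining_gap (unserved (c / B) (n - k)) (A / B - sum_list h - z)
        - c / B * z\<^sup>2)" if "z \<ge> 0" for z
      using assms(1-4) that follow by (rule payoff_continuation)
    moreover have "y * remaining_gap (unserved (c / B) (n - k)) (A / B - sum_list h - y)
        - c / B * y\<^sup>2
      < ?t * remaining_gap (unserved (c / B) (n - k)) (A / B - sum_list h - ?t) - c / B * ?t\<^sup>2"
      using leader_optimum[OF unserved_pos, of "c / B" "c / B" y "n - k" "A / B - sum_list h"]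
        y assms(1,2) by (simp add: stackelberg_reply_def)
    ultimately show ?thesis using t y(1) assms(1) by simp
  qed
  show ?thesis
  proof
    assume ?optimal
    then have "?\<pi> ?t \<le> ?\<pi> x" using t by blast
    then show "x = ?t" using better[of x] assms(5) by force
  next
    assume "x = ?t"
    then show ?optimal using better less_imp_le by (metis order_refl)
  qed
qed

text \<open>
  From left to right, the induction is over the number \<open>n - k\<close> of firms that move later: once
  their strategies are known, the best choice of firm \<open>k\<close> is forced.
\<close>

lemma subgame_perfect_iff_reply:
  assumes "B > 0" "c > 0"
  shows "subgame_perfect A B (\<lambda>i x. c * x\<^sup>2) n \<sigma> \<longleftrightarrow>
    \<sigma> \<in> profiles n \<and>
    (\<forall>k\<in>{1..n}. \<forall>h\<in>histories k. \<sigma> k h = stackelberg_reply (A / B) (c / B) n k h)"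
proof (cases "\<sigma> \<in> profiles n")
  case True
  then have nonneg: "\<sigma> k h \<ge> 0" if "k \<in> {1..n}" "h \<in> histories k" for k h
    using that by (fastforce simp: profiles_def dest!: PiE_mem)
  have forced: "\<sigma> k h = stackelberg_reply (A / B) (c / B) n k h"
    if sp: "subgame_perfect A B (\<lambda>i x. c * x\<^sup>2) n \<sigma>" and "k \<in> {1..n}" "h \<in> histories k" for k h
    using that(2,3)
  proof (induction "n - k" arbitrary: k h rule: less_induct)
    case less
    have "\<And>j g. k < j \<Longrightarrow> j \<le> n \<Longrightarrow> g \<in> histories j \<Longrightarrow>
        \<sigma> j g = stackelberg_reply (A / B) (c / B) n j g"
      using less.prems(1) by (intro less.hyps) auto
    note optimal_iff_reply[OF assms less.prems nonneg[OF less.prems] this]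
    then show ?case using sp less.prems unfolding subgame_perfect_def by blast
  qed
  have "subgame_perfect A B (\<lambda>i x. c * x\<^sup>2) n \<sigma>"
    if follow: "\<forall>k\<in>{1..n}. \<forall>h\<in>histories k. \<sigma> k h = stackelberg_reply (A / B) (c / B) n k h"
    unfolding subgame_perfect_def
  proof (intro conjI True ballI)
    fix k h
    assume kh: "k \<in> {1..n}" "h \<in> histories k"
    have "\<And>j g. k < j \<Longrightarrow> j \<le> n \<Longrightarrow> g \<in> histories j \<Longrightarrow>
        \<sigma> j g = stackelberg_reply (A / B) (c / B) n j g"
      using follow by simp
    note optimal_iff_reply[OF assms kh nonneg[OF kh] this]
    then show "\<forall>y\<ge>0. payoff A B (\<lambda>i x. c * x\<^sup>2) k (outcome n \<sigma> (h @ [y])) \<le>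
        payoff A B (\<lambda>i x. c * x\<^sup>2) k (outcome n \<sigma> (h @ [\<sigma> k h]))"
      using follow kh by blast
  qed
  then show ?thesis using True forced by blast
next
  case False
  then show ?thesis by (simp add: subgame_perfect_def)
qed

lemma subgame_perfect_iff_eq:
  assumes "B > 0" "c > 0"
  shows "subgame_perfect A B (\<lambda>i x. c * x\<^sup>2) n \<sigma> \<longleftrightarrow>
    \<sigma> = stackelberg_profile (A / B) (c / B) n"
proof
  assume "subgame_perfect A B (\<lambda>i x. c * x\<^sup>2) n \<sigma>"
  then have "\<sigma> \<in> profiles n" and
    reply: "\<forall>k\<in>{1..n}. \<forall>h\<in>histories k. \<sigma> k h = stackelberg_reply (A / B) (c / B) n k h"
    using subgame_perfect_iff_reply[OF assms] by auto
  show "\<sigma> = stackelberg_profile (A / B) (c / B) n"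
  proof (intro ext)
    fix k h
    show "\<sigma> k h = stackelberg_profile (A / B) (c / B) n k h"
    proof (cases "k \<in> {1..n}")
      case True
      have "\<sigma> k \<in> histories k \<rightarrow>\<^sub>E {0..}"
        using \<open>\<sigma> \<in> profiles n\<close> True unfolding profiles_def by (rule PiE_mem)
      then show ?thesis
        using True reply PiE_arb[of "\<sigma> k" "histories k" "\<lambda>_. {0..}" h]
        by (cases "h \<in> histories k") (simp_all add: stackelberg_profile_def)
    next
      case False
      have "\<sigma> k = undefined"
        using \<open>\<sigma> \<in> profiles n\<close> False unfolding profiles_def by (rule PiE_arb)
      then show ?thesis using False by (auto simp: stackelberg_profile_def)
    qed
  qed
next
  assume eq: "\<sigma> = stackelberg_profile (A / B) (c / B) n"
  have "\<sigma> \<in> profiles n"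
    unfolding eq stackelberg_profile_def profiles_def
    using assms by (auto simp: stackelberg_reply_nonneg)
  then show "subgame_perfect A B (\<lambda>i x. c * x\<^sup>2) n \<sigma>"
    using subgame_perfect_iff_reply[OF assms] by (simp add: eq stackelberg_profile_def)
qed

section \<open>Aggregate output in equilibrium\<close>

lemma stackelberg_output_eq:
  assumes "A > 0" "B > 0" "c > 0"
  shows "stackelberg_output A B (\<lambda>i x. c * x\<^sup>2) n = A / B * (1 - unserved (c / B) n)"
proof -
  let ?\<sigma> = "stackelberg_profile (A / B) (c / B) n"
  have "(THE \<sigma>. subgame_perfect A B (\<lambda>i x. c * x\<^sup>2) n \<sigma>) = ?\<sigma>"
    using subgame_perfect_iff_eq[OF assms(2,3)] by simp
  moreover have "A / B - sum_list (continue ?\<sigma> n []) =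
      remaining_gap (unserved (c / B) n) (A / B - sum_list [])"
    using assms by (intro gap_continue) (auto simp: stackelberg_profile_def)
  ultimately show ?thesis
    using assms by (simp add: stackelberg_output_def outcome_def remaining_gap_def algebra_simps)
qed

theorem proposition8:
  fixes A B c M :: real
    and C :: "nat \<Rightarrow> real \<Rightarrow> real"
    and Q P q :: "nat \<Rightarrow> real"
  assumes "A > 0" and "B > 0" and "c > 0"
    and "M = A / B"
    and "\<And>i x. C i x = c * x\<^sup>2"
    and "\<And>n. Q n = stackelberg_output A B C n"
    and "\<And>n. P n = A - B * Q n"
    and "\<And>n. q n = Q n / M"
  shows "(\<forall>n. \<exists>!\<sigma>. subgame_perfect A B C n \<sigma>)
    \<and> (\<forall>n. 0 \<le> q n \<and> q n < 1)
    \<and> (\<forall>n\<ge>1. q n > q (n - 1))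
    \<and> q \<longlonglongrightarrow> 1
    \<and> Q \<longlonglongrightarrow> M
    \<and> P \<longlonglongrightarrow> 0"
proof -
  define a where "a = unserved (c / B)"
  have C: "C = (\<lambda>i x. c * x\<^sup>2)" using assms(5) by blast
  have "M > 0" and d: "c / B > 0" using assms(1-4) by simp_all
  have Q: "Q n = M * (1 - a n)" for n
    using stackelberg_output_eq[OF assms(1-3)] by (simp add: assms(4,6) C a_def)
  have q: "q n = 1 - a n" for n using \<open>M > 0\<close> by (simp add: assms(8) Q)
  have unique: "\<exists>!\<sigma>. subgame_perfect A B C n \<sigma>" for n
    using subgame_perfect_iff_eq[OF assms(2,3)] by (simp add: C)
  have bounds: "0 \<le> q n \<and> q n < 1" for n
    using unserved_le_1[OF d] unserved_pos[OF d] by (simp add: q a_def)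
  have increasing: "q n > q (n - 1)" if "n \<ge> 1" for n
    using that unserved_decreasing[OF d, of "n - 1"] by (simp add: q a_def del: unserved.simps)
  have "a \<longlonglongrightarrow> 0" unfolding a_def using d by (rule unserved_tendsto_0)
  then have "(\<lambda>n. 1 - a n) \<longlonglongrightarrow> 1 - 0" by (intro tendsto_intros)
  moreover have "q = (\<lambda>n. 1 - a n)" using q by blast
  ultimately have q_lim: "q \<longlonglongrightarrow> 1" by simp
  have "(\<lambda>n. M * q n) \<longlonglongrightarrow> M * 1" using q_lim by (intro tendsto_intros)
  moreover have "Q = (\<lambda>n. M * q n)" using Q q by auto
  ultimately have Q_lim: "Q \<longlonglongrightarrow> M" by simp
  have "(\<lambda>n. A - B * Q n) \<longlonglongrightarrow> A - B * M" using Q_lim by (intro tendsto_intros)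
  moreover have "P = (\<lambda>n. A - B * Q n)" using assms(7) by blast
  ultimately have P_lim: "P \<longlonglongrightarrow> 0" using assms(2,4) by simp
  show ?thesis using unique bounds increasing q_lim Q_lim P_lim by blast
qed

end
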